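(* Let $\Gamma$ be the set of axioms of von Plato's axiomatization of ordered affine geometry other than I.5, I.6, I.7, I.8; only the fact that $\Gamma$ is a fixed set of first-order sentences, in a language containing a sort of lines, the binary relation $\mathrm{Undir}$ on lines and the unary function $\mathrm{rev}$ from lines to lines, is used, so $\Gamma$ may be taken to be an arbitrary such set. Let von Plato's axiomatization be $$\Gamma\cup\{\text{I.5},\text{I.6},\text{I.7},\text{I.8}\},$$ and let the axiomatization 2, obtained from it by replacing I.6 with ODO, be $$\Gamma\cup\{\text{I.5},\text{ODO},\text{I.7},\text{I.8}\},$$ where the sentences I.5, I.6, I.7, I.8 and ODO are the following, with all variables ranging over lines. I.5: $\forall l\ \neg \mathrm{Undir}(l,l)$. I.6: $\forall l\,\forall m\,\forall n\ \big[\mathrm{Undir}(l,m)\rightarrow \mathrm{Undir}(l,n)\vee \mathrm{Undir}(m,n)\big]$. I.7: $\forall l\,\forall m\,\forall n\ \big[\mathrm{Undir}(l,m)\wedge \mathrm{Undir}(l,\mathrm{rev}(m))\rightarrow (\mathrm{Undir}(l,n)\wedge \mathrm{Undir}(l,\mathrm{rev}(n)))\vee(\mathrm{Undir}(m,n)\wedge \mathrm{Undir}(m,\mathrm{rev}(n)))\big]$. I.8: $\forall l\,\forall m\ \big[\mathrm{Undir}(l,m)\vee \mathrm{Undir}(l,\mathrm{rev}(m))\big]$. ODO: $\forall l\,\forall m\,\forall n\ \big[\neg \mathrm{Undir}(l,\mathrm{rev}(m))\wedge\neg \mathrm{Undir}(l,n)\rightarrow \neg \mathrm{Undir}(m,\mathrm{rev}(n))\big]$.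 Then the two axiomatizations are equivalent: every axiom of each is derivable in classical first-order logic from the axioms of the other.
   Context: $\mathrm{Undir}(l,m)$ is a primitive binary relation on lines, read "$l$ and $m$ are unequally directed lines", and $\mathrm{rev}(l)$ is a primitive unary function on lines, read "the reverse of the line $l$". No properties of $\mathrm{Undir}$ and $\mathrm{rev}$ are assumed beyond the listed axioms. Von Plato's axiomatization of ordered affine geometry has 22 axioms in total; the 18 axioms other than I.5-I.8 are kept unchanged in both axiomatizations, and $\mathrm{Undir}$ and $\mathrm{rev}$ are the only non-logical symbols occurring in I.5-I.8 and ODO. The logic is classical first-order logic. *)

theory Defs
  imports Main
begin

section \<open>Many-sorted first-order logic\<close>

text \<open>
  Equality is not a logical symbol. If a theory uses it, it is one of the predicate symbols, with its
  axioms among those of the theory.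
\<close>

record ('s, 'f, 'p) signature =
  fun_rank :: "'f \<Rightarrow> 's list \<times> 's"
  pred_rank :: "'p \<Rightarrow> 's list"

text \<open>A variable is a name paired with its sort, so every sort has its own countable supply.\<close>

type_synonym 's var = "nat \<times> 's"

datatype ('s, 'f) tm = Var "'s var" | App 'f "('s, 'f) tm list"

datatype ('s, 'f, 'p) fm =
    Falsum  (\<open>\<^bold>\<bottom>\<close>)
  | Atom 'p "('s, 'f) tm list"
  | Imp "('s, 'f, 'p) fm" "('s, 'f, 'p) fm"  (infixr \<open>\<^bold>\<longrightarrow>\<close> 55)
  | Conj "('s, 'f, 'p) fm" "('s, 'f, 'p) fm"  (infixr \<open>\<^bold>\<and>\<close> 65)
  | Disj "('s, 'f, 'p) fm" "('s, 'f, 'p) fm"  (infixr \<open>\<^bold>\<or>\<close> 60)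
  | All "'s var" "('s, 'f, 'p) fm"
  | Ex "'s var" "('s, 'f, 'p) fm"

abbreviation Neg :: "('s, 'f, 'p) fm \<Rightarrow> ('s, 'f, 'p) fm"  (\<open>\<^bold>\<not> _\<close> [70] 70)
  where "\<^bold>\<not> \<phi> \<equiv> \<phi> \<^bold>\<longrightarrow> \<^bold>\<bottom>"

primrec sort_of :: "('s, 'f, 'p) signature \<Rightarrow> ('s, 'f) tm \<Rightarrow> 's" where
  "sort_of \<Sigma> (Var x) = snd x"
| "sort_of \<Sigma> (App f ts) = snd (fun_rank \<Sigma> f)"

fun wf_tm :: "('s, 'f, 'p) signature \<Rightarrow> ('s, 'f) tm \<Rightarrow> bool" where
  "wf_tm \<Sigma> (Var x) \<longleftrightarrow> True"
| "wf_tm \<Sigma> (App f ts) \<longleftrightarrow>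
     map (sort_of \<Sigma>) ts = fst (fun_rank \<Sigma> f) \<and> (\<forall>t \<in> set ts. wf_tm \<Sigma> t)"

primrec wf_fm :: "('s, 'f, 'p) signature \<Rightarrow> ('s, 'f, 'p) fm \<Rightarrow> bool" where
  "wf_fm \<Sigma> \<^bold>\<bottom> \<longleftrightarrow> True"
| "wf_fm \<Sigma> (Atom p ts) \<longleftrightarrow>
     map (sort_of \<Sigma>) ts = pred_rank \<Sigma> p \<and> (\<forall>t \<in> set ts. wf_tm \<Sigma> t)"
| "wf_fm \<Sigma> (\<phi> \<^bold>\<longrightarrow> \<psi>) \<longleftrightarrow> wf_fm \<Sigma> \<phi> \<and> wf_fm \<Sigma> \<psi>"
| "wf_fm \<Sigma> (\<phi> \<^bold>\<and> \<psi>) \<longleftrightarrow> wf_fm \<Sigma> \<phi> \<and> wf_fm \<Sigma> \<psi>"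
| "wf_fm \<Sigma> (\<phi> \<^bold>\<or> \<psi>) \<longleftrightarrow> wf_fm \<Sigma> \<phi> \<and> wf_fm \<Sigma> \<psi>"
| "wf_fm \<Sigma> (All x \<phi>) \<longleftrightarrow> wf_fm \<Sigma> \<phi>"
| "wf_fm \<Sigma> (Ex x \<phi>) \<longleftrightarrow> wf_fm \<Sigma> \<phi>"

fun vars_tm :: "('s, 'f) tm \<Rightarrow> 's var set" where
  "vars_tm (Var x) = {x}"
| "vars_tm (App f ts) = (\<Union>t \<in> set ts. vars_tm t)"

primrec fv :: "('s, 'f, 'p) fm \<Rightarrow> 's var set" where
  "fv \<^bold>\<bottom> = {}"
| "fv (Atom p ts) = (\<Union>t \<in> set ts. vars_tm t)"
| "fv (\<phi> \<^bold>\<longrightarrow> \<psi>) = fv \<phi> \<union> fv \<psi>"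
| "fv (\<phi> \<^bold>\<and> \<psi>) = fv \<phi> \<union> fv \<psi>"
| "fv (\<phi> \<^bold>\<or> \<psi>) = fv \<phi> \<union> fv \<psi>"
| "fv (All x \<phi>) = fv \<phi> - {x}"
| "fv (Ex x \<phi>) = fv \<phi> - {x}"

definition sentence :: "('s, 'f, 'p) signature \<Rightarrow> ('s, 'f, 'p) fm \<Rightarrow> bool"
  where "sentence \<Sigma> \<phi> \<longleftrightarrow> wf_fm \<Sigma> \<phi> \<and> fv \<phi> = {}"

fun subst_tm :: "'s var \<Rightarrow> ('s, 'f) tm \<Rightarrow> ('s, 'f) tm \<Rightarrow> ('s, 'f) tm" where
  "subst_tm x t (Var y) = (if y = x then t else Var y)"
| "subst_tm x t (App f ts) = App f (map (subst_tm x t) ts)"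

text \<open>
  Substitution of \<open>t\<close> for the free occurrences of \<open>x\<close>, without renaming of bound variables; it is only
  used under the side condition \<open>free_for t x \<phi>\<close>, which says that no variable of \<open>t\<close> gets captured.
\<close>

primrec subst :: "'s var \<Rightarrow> ('s, 'f) tm \<Rightarrow> ('s, 'f, 'p) fm \<Rightarrow> ('s, 'f, 'p) fm" where
  "subst x t \<^bold>\<bottom> = \<^bold>\<bottom>"
| "subst x t (Atom p ts) = Atom p (map (subst_tm x t) ts)"
| "subst x t (\<phi> \<^bold>\<longrightarrow> \<psi>) = subst x t \<phi> \<^bold>\<longrightarrow> subst x t \<psi>"
| "subst x t (\<phi> \<^bold>\<and> \<psi>) = subst x t \<phi> \<^bold>\<and> subst x t \<psi>"
| "subst x t (\<phi> \<^bold>\<or> \<psi>) = subst x t \<phi> \<^bold>\<or> subst x t \<psi>"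
| "subst x t (All y \<phi>) = All y (if y = x then \<phi> else subst x t \<phi>)"
| "subst x t (Ex y \<phi>) = Ex y (if y = x then \<phi> else subst x t \<phi>)"

primrec free_for :: "('s, 'f) tm \<Rightarrow> 's var \<Rightarrow> ('s, 'f, 'p) fm \<Rightarrow> bool" where
  "free_for t x \<^bold>\<bottom> \<longleftrightarrow> True"
| "free_for t x (Atom p ts) \<longleftrightarrow> True"
| "free_for t x (\<phi> \<^bold>\<longrightarrow> \<psi>) \<longleftrightarrow> free_for t x \<phi> \<and> free_for t x \<psi>"
| "free_for t x (\<phi> \<^bold>\<and> \<psi>) \<longleftrightarrow> free_for t x \<phi> \<and> free_for t x \<psi>"
| "free_for t x (\<phi> \<^bold>\<or> \<psi>) \<longleftrightarrow> free_for t x \<phi> \<and> free_for t x \<psi>"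
| "free_for t x (All y \<phi>) \<longleftrightarrow> (x \<in> fv (All y \<phi>) \<longrightarrow> y \<notin> vars_tm t \<and> free_for t x \<phi>)"
| "free_for t x (Ex y \<phi>) \<longleftrightarrow> (x \<in> fv (Ex y \<phi>) \<longrightarrow> y \<notin> vars_tm t \<and> free_for t x \<phi>)"

text \<open>
  Classical natural deduction. The well-formedness premises ensure that only well-sorted formulas
  occur in a derivation. The set \<open>A\<close> of open assumptions may be infinite.
\<close>

inductive derivable ::
  "('s, 'f, 'p) signature \<Rightarrow> ('s, 'f, 'p) fm set \<Rightarrow> ('s, 'f, 'p) fm \<Rightarrow> bool"
  (\<open>_, _ \<turnstile> _\<close> [51, 51, 51] 50)
  for \<Sigma> :: "('s, 'f, 'p) signature"
where
  Assm: "\<phi> \<in> A \<Longrightarrow> wf_fm \<Sigma> \<phi> \<Longrightarrow> \<Sigma>, A \<turnstile> \<phi>"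
| RAA: "\<Sigma>, insert (\<^bold>\<not> \<phi>) A \<turnstile> \<^bold>\<bottom> \<Longrightarrow> wf_fm \<Sigma> \<phi> \<Longrightarrow> \<Sigma>, A \<turnstile> \<phi>"
| ImpI: "\<Sigma>, insert \<phi> A \<turnstile> \<psi> \<Longrightarrow> wf_fm \<Sigma> \<phi> \<Longrightarrow> \<Sigma>, A \<turnstile> \<phi> \<^bold>\<longrightarrow> \<psi>"
| ImpE: "\<Sigma>, A \<turnstile> \<phi> \<^bold>\<longrightarrow> \<psi> \<Longrightarrow> \<Sigma>, A \<turnstile> \<phi> \<Longrightarrow> \<Sigma>, A \<turnstile> \<psi>"
| ConjI: "\<Sigma>, A \<turnstile> \<phi> \<Longrightarrow> \<Sigma>, A \<turnstile> \<psi> \<Longrightarrow> \<Sigma>, A \<turnstile> \<phi> \<^bold>\<and> \<psi>"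
| ConjE1: "\<Sigma>, A \<turnstile> \<phi> \<^bold>\<and> \<psi> \<Longrightarrow> \<Sigma>, A \<turnstile> \<phi>"
| ConjE2: "\<Sigma>, A \<turnstile> \<phi> \<^bold>\<and> \<psi> \<Longrightarrow> \<Sigma>, A \<turnstile> \<psi>"
| DisjI1: "\<Sigma>, A \<turnstile> \<phi> \<Longrightarrow> wf_fm \<Sigma> \<psi> \<Longrightarrow> \<Sigma>, A \<turnstile> \<phi> \<^bold>\<or> \<psi>"
| DisjI2: "\<Sigma>, A \<turnstile> \<psi> \<Longrightarrow> wf_fm \<Sigma> \<phi> \<Longrightarrow> \<Sigma>, A \<turnstile> \<phi> \<^bold>\<or> \<psi>"
| DisjE: "\<Sigma>, A \<turnstile> \<phi> \<^bold>\<or> \<psi> \<Longrightarrow> \<Sigma>, insert \<phi> A \<turnstile> \<chi> \<Longrightarrow> \<Sigma>, insert \<psi> A \<turnstile> \<chi> \<Longrightarrow> \<Sigma>, A \<turnstile> \<chi>"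
| AllI: "\<Sigma>, A \<turnstile> subst x (Var y) \<phi> \<Longrightarrow> snd y = snd x \<Longrightarrow> free_for (Var y) x \<phi> \<Longrightarrow>
    y \<notin> fv (All x \<phi>) \<Longrightarrow> \<forall>\<alpha> \<in> A. y \<notin> fv \<alpha> \<Longrightarrow> \<Sigma>, A \<turnstile> All x \<phi>"
| AllE: "\<Sigma>, A \<turnstile> All x \<phi> \<Longrightarrow> wf_tm \<Sigma> t \<Longrightarrow> sort_of \<Sigma> t = snd x \<Longrightarrow> free_for t x \<phi> \<Longrightarrow>
    \<Sigma>, A \<turnstile> subst x t \<phi>"
| ExI: "\<Sigma>, A \<turnstile> subst x t \<phi> \<Longrightarrow> wf_tm \<Sigma> t \<Longrightarrow> sort_of \<Sigma> t = snd x \<Longrightarrow> free_for t x \<phi> \<Longrightarrow>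
    \<Sigma>, A \<turnstile> Ex x \<phi>"
| ExE: "\<Sigma>, A \<turnstile> Ex x \<phi> \<Longrightarrow> \<Sigma>, insert (subst x (Var y) \<phi>) A \<turnstile> \<chi> \<Longrightarrow>
    snd y = snd x \<Longrightarrow> free_for (Var y) x \<phi> \<Longrightarrow>
    y \<notin> fv (Ex x \<phi>) \<Longrightarrow> y \<notin> fv \<chi> \<Longrightarrow> \<forall>\<alpha> \<in> A. y \<notin> fv \<alpha> \<Longrightarrow> \<Sigma>, A \<turnstile> \<chi>"

definition equivalent_axiomatizations ::
  "('s, 'f, 'p) signature \<Rightarrow> ('s, 'f, 'p) fm set \<Rightarrow> ('s, 'f, 'p) fm set \<Rightarrow> bool"
  where "equivalent_axiomatizations \<Sigma> A B \<longleftrightarrow> (\<forall>\<phi> \<in> A. \<Sigma>, B \<turnstile> \<phi>) \<and> (\<forall>\<phi> \<in> B. \<Sigma>, A \<turnstile> \<phi>)"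


section \<open>The axioms on unequally directed lines\<close>

text \<open>
  The parameters are the sort \<open>L\<close> of lines, the predicate symbol \<open>U\<close> for \<open>Undir\<close>
  and the function symbol \<open>r\<close> for the reverse of a line.
\<close>

abbreviation (input) lv :: "'s \<Rightarrow> 's var" where "lv L \<equiv> (0, L)"
abbreviation (input) mv :: "'s \<Rightarrow> 's var" where "mv L \<equiv> (1, L)"
abbreviation (input) nv :: "'s \<Rightarrow> 's var" where "nv L \<equiv> (2, L)"

definition I5 :: "'s \<Rightarrow> 'p \<Rightarrow> ('s, 'f, 'p) fm" where
  "I5 L U = (let l = Var (lv L) in
     All (lv L) (\<^bold>\<not> Atom U [l, l]))"

definition I6 :: "'s \<Rightarrow> 'p \<Rightarrow> ('s, 'f, 'p) fm" where
  "I6 L U = (let l = Var (lv L); m = Var (mv L); n = Var (nv L) in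
     All (lv L) (All (mv L) (All (nv L)
       (Atom U [l, m] \<^bold>\<longrightarrow> Atom U [l, n] \<^bold>\<or> Atom U [m, n]))))"

definition I7 :: "'s \<Rightarrow> 'p \<Rightarrow> 'f \<Rightarrow> ('s, 'f, 'p) fm" where
  "I7 L U r = (let l = Var (lv L); m = Var (mv L); n = Var (nv L) in
     All (lv L) (All (mv L) (All (nv L)
       (Atom U [l, m] \<^bold>\<and> Atom U [l, App r [m]] \<^bold>\<longrightarrow>
         (Atom U [l, n] \<^bold>\<and> Atom U [l, App r [n]]) \<^bold>\<or> (Atom U [m, n] \<^bold>\<and> Atom U [m, App r [n]])))))"

definition I8 :: "'s \<Rightarrow> 'p \<Rightarrow> 'f \<Rightarrow> ('s, 'f, 'p) fm" where
  "I8 L U r = (let l = Var (lv L); m = Var (mv L) in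
     All (lv L) (All (mv L) (Atom U [l, m] \<^bold>\<or> Atom U [l, App r [m]])))"

definition ODO :: "'s \<Rightarrow> 'p \<Rightarrow> 'f \<Rightarrow> ('s, 'f, 'p) fm" where
  "ODO L U r = (let l = Var (lv L); m = Var (mv L); n = Var (nv L) in
     All (lv L) (All (mv L) (All (nv L)
       (\<^bold>\<not> Atom U [l, App r [m]] \<^bold>\<and> \<^bold>\<not> Atom U [l, n] \<^bold>\<longrightarrow> \<^bold>\<not> Atom U [m, App r [n]]))))"

end

theory Submission
  imports Defs
begin

text \<open>
  Write \<open>l \<parallel> m\<close> for the negation of \<open>Undir(l, m)\<close>.

  For ODO, let \<open>l \<parallel> rev m\<close> and \<open>l \<parallel> n\<close>; I.5 and I.6 give \<open>n \<parallel> rev m\<close>. If \<open>m \<parallel> rev n\<close> failed, then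
  I.7, taken at \<open>m, n, m\<close>, would give \<open>m \<parallel> n\<close>, hence \<open>n \<parallel> m\<close> together with \<open>n \<parallel> rev m\<close>, contradicting
  I.8.

  For I.6, let \<open>l \<parallel> n\<close> and \<open>m \<parallel> n\<close>. If \<open>l \<parallel> m\<close> failed, then I.7 would give \<open>l \<parallel> rev m\<close>, and ODO would
  give \<open>m \<parallel> rev n\<close> together with \<open>m \<parallel> n\<close>, contradicting I.8.

  Both arguments are carried out on the terms substituted for the bound variables. Since all axioms
  are closed, the variables \<open>3\<close>, \<open>4\<close>, \<open>5\<close> serve as eigenvariables, and they are not captured by the
  quantifiers of the axioms, which bind \<open>0\<close>, \<open>1\<close>, \<open>2\<close>.
\<close>

section \<open>Propositional rules\<close>

text \<open>
  Each rule is obtained from an implication proved in the same context, so that no weakening of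
  derivations is needed.
\<close>

lemma neg_disjI:
  assumes "\<Sigma>, A \<turnstile> \<^bold>\<not> \<phi>" "\<Sigma>, A \<turnstile> \<^bold>\<not> \<psi>" "wf_fm \<Sigma> \<phi>" "wf_fm \<Sigma> \<psi>"
  shows "\<Sigma>, A \<turnstile> \<^bold>\<not> (\<phi> \<^bold>\<or> \<psi>)"
proof -
  \<comment> \<open>The assumptions are nested in the order in which \<open>ImpI\<close> discharges
    them, the last discharged formula innermost.\<close>
  let ?B = "insert (\<phi> \<^bold>\<or> \<psi>) (insert (\<^bold>\<not> \<psi>) (insert (\<^bold>\<not> \<phi>) A))"
  have "\<Sigma>, ?B \<turnstile> \<^bold>\<bottom>"
  proof (rule DisjE)
    show "\<Sigma>, ?B \<turnstile> \<phi> \<^bold>\<or> \<psi>" by (rule Assm) (use assms in simp_all)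
    show "\<Sigma>, insert \<phi> ?B \<turnstile> \<^bold>\<bottom>"
      by (rule ImpE[of _ _ \<phi>]; rule Assm) (use assms in simp_all)
    show "\<Sigma>, insert \<psi> ?B \<turnstile> \<^bold>\<bottom>"
      by (rule ImpE[of _ _ \<psi>]; rule Assm) (use assms in simp_all)
  qed
  then have "\<Sigma>, A \<turnstile> \<^bold>\<not> \<phi> \<^bold>\<longrightarrow> \<^bold>\<not> \<psi> \<^bold>\<longrightarrow> \<^bold>\<not> (\<phi> \<^bold>\<or> \<psi>)"
    using assms(3,4) by (intro ImpI) simp_all
  then show ?thesis using assms(1,2) ImpE by blast
qed

lemma neg_disjD1:
  assumes "\<Sigma>, A \<turnstile> \<^bold>\<not> (\<phi> \<^bold>\<or> \<psi>)" "wf_fm \<Sigma> \<phi>" "wf_fm \<Sigma> \<psi>"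
  shows "\<Sigma>, A \<turnstile> \<^bold>\<not> \<phi>"
proof -
  have "\<Sigma>, insert \<phi> (insert (\<^bold>\<not> (\<phi> \<^bold>\<or> \<psi>)) A) \<turnstile> \<^bold>\<bottom>"
    by (rule ImpE[of _ _ "\<phi> \<^bold>\<or> \<psi>"]) (use assms in \<open>auto intro: Assm DisjI1\<close>)
  then have "\<Sigma>, A \<turnstile> \<^bold>\<not> (\<phi> \<^bold>\<or> \<psi>) \<^bold>\<longrightarrow> \<^bold>\<not> \<phi>"
    using assms(2,3) by (intro ImpI) simp_all
  then show ?thesis using assms(1) ImpE by blast
qed

lemma neg_disjD2:
  assumes "\<Sigma>, A \<turnstile> \<^bold>\<not> (\<phi> \<^bold>\<or> \<psi>)" "wf_fm \<Sigma> \<phi>" "wf_fm \<Sigma> \<psi>"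
  shows "\<Sigma>, A \<turnstile> \<^bold>\<not> \<psi>"
proof -
  have "\<Sigma>, insert \<psi> (insert (\<^bold>\<not> (\<phi> \<^bold>\<or> \<psi>)) A) \<turnstile> \<^bold>\<bottom>"
    by (rule ImpE[of _ _ "\<phi> \<^bold>\<or> \<psi>"]) (use assms in \<open>auto intro: Assm DisjI2\<close>)
  then have "\<Sigma>, A \<turnstile> \<^bold>\<not> (\<phi> \<^bold>\<or> \<psi>) \<^bold>\<longrightarrow> \<^bold>\<not> \<psi>"
    using assms(2,3) by (intro ImpI) simp_all
  then show ?thesis using assms(1) ImpE by blast
qed

lemma modus_tollens:
  assumes "\<Sigma>, A \<turnstile> \<phi> \<^bold>\<longrightarrow> \<psi>" "\<Sigma>, A \<turnstile> \<^bold>\<not> \<psi>" "wf_fm \<Sigma> \<phi>" "wf_fm \<Sigma> \<psi>"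
  shows "\<Sigma>, A \<turnstile> \<^bold>\<not> \<phi>"
proof -
  let ?B = "insert \<phi> (insert (\<^bold>\<not> \<psi>) (insert (\<phi> \<^bold>\<longrightarrow> \<psi>) A))"
  have "\<Sigma>, ?B \<turnstile> \<psi>"
    by (rule ImpE[of _ _ \<phi>]; rule Assm) (use assms in simp_all)
  then have "\<Sigma>, ?B \<turnstile> \<^bold>\<bottom>"
    by (rule ImpE[of _ _ \<psi>, rotated]) (rule Assm, use assms in simp_all)
  then have "\<Sigma>, A \<turnstile> (\<phi> \<^bold>\<longrightarrow> \<psi>) \<^bold>\<longrightarrow> \<^bold>\<not> \<psi> \<^bold>\<longrightarrow> \<^bold>\<not> \<phi>"
    using assms(3,4) by (intro ImpI) simp_all
  then show ?thesis using assms(1,2) ImpE by blast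
qed

lemma neg_conjI1:
  assumes "\<Sigma>, A \<turnstile> \<^bold>\<not> \<phi>" "wf_fm \<Sigma> \<phi>" "wf_fm \<Sigma> \<psi>"
  shows "\<Sigma>, A \<turnstile> \<^bold>\<not> (\<phi> \<^bold>\<and> \<psi>)"
proof (rule modus_tollens)
  show "\<Sigma>, A \<turnstile> \<phi> \<^bold>\<and> \<psi> \<^bold>\<longrightarrow> \<phi>"
    using assms(2,3) by (intro ImpI ConjE1[of _ _ \<phi> \<psi>] Assm) simp_all
qed (use assms in simp_all)

lemma neg_conjI2:
  assumes "\<Sigma>, A \<turnstile> \<^bold>\<not> \<psi>" "wf_fm \<Sigma> \<phi>" "wf_fm \<Sigma> \<psi>"
  shows "\<Sigma>, A \<turnstile> \<^bold>\<not> (\<phi> \<^bold>\<and> \<psi>)"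
proof (rule modus_tollens)
  show "\<Sigma>, A \<turnstile> \<phi> \<^bold>\<and> \<psi> \<^bold>\<longrightarrow> \<psi>"
    using assms(2,3) by (intro ImpI ConjE2[of _ _ \<phi> \<psi>] Assm) simp_all
qed (use assms in simp_all)

lemma neg_conjD1:
  assumes "\<Sigma>, A \<turnstile> \<^bold>\<not> (\<phi> \<^bold>\<and> \<psi>)" "\<Sigma>, A \<turnstile> \<psi>" "wf_fm \<Sigma> \<phi>" "wf_fm \<Sigma> \<psi>"
  shows "\<Sigma>, A \<turnstile> \<^bold>\<not> \<phi>"
proof -
  \<comment> \<open>Pairing is curried with the given conjunct first, so that one
    \<open>ImpE\<close> leaves an implication to contrapose.\<close>
  have "\<Sigma>, A \<turnstile> \<psi> \<^bold>\<longrightarrow> \<phi> \<^bold>\<longrightarrow> \<phi> \<^bold>\<and> \<psi>"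
    using assms(3,4) by (auto intro!: ImpI ConjI intro: Assm)
  then have "\<Sigma>, A \<turnstile> \<phi> \<^bold>\<longrightarrow> \<phi> \<^bold>\<and> \<psi>" using assms(2) ImpE by blast
  then show ?thesis using assms by (auto intro: modus_tollens[of _ _ _ "\<phi> \<^bold>\<and> \<psi>"])
qed

lemma neg_conjD2:
  assumes "\<Sigma>, A \<turnstile> \<^bold>\<not> (\<phi> \<^bold>\<and> \<psi>)" "\<Sigma>, A \<turnstile> \<phi>" "wf_fm \<Sigma> \<phi>" "wf_fm \<Sigma> \<psi>"
  shows "\<Sigma>, A \<turnstile> \<^bold>\<not> \<psi>"
proof -
  have "\<Sigma>, A \<turnstile> \<phi> \<^bold>\<longrightarrow> \<psi> \<^bold>\<longrightarrow> \<phi> \<^bold>\<and> \<psi>"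
    using assms(3,4) by (auto intro!: ImpI ConjI intro: Assm)
  then have "\<Sigma>, A \<turnstile> \<psi> \<^bold>\<longrightarrow> \<phi> \<^bold>\<and> \<psi>" using assms(2) ImpE by blast
  then show ?thesis using assms by (auto intro: modus_tollens[of _ _ _ "\<phi> \<^bold>\<and> \<psi>"])
qed

section \<open>Instances of the axioms\<close>

text \<open>Instantiating nested quantifiers substitutes one variable after another; a term inserted
  earlier has to survive the later substitutions.\<close>

lemma subst_tm_fresh: "x \<notin> vars_tm t \<Longrightarrow> subst_tm x u t = t"
  by (induction t) (auto intro: map_idI)

locale line_signature =
  fixes \<Sigma> :: "('s, 'f, 'p) signature" and L :: 's and U :: 'p and r :: 'f
  assumes rank_U: "pred_rank \<Sigma> U = [L, L]"
    and rank_r: "fun_rank \<Sigma> r = ([L], L)"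
begin

text \<open>Avoiding the three bound names excludes capture by the quantifiers of the axioms and
  makes successive substitution agree with simultaneous substitution.\<close>

definition line_tm :: "('s, 'f) tm \<Rightarrow> bool" where
  "line_tm t \<longleftrightarrow> wf_tm \<Sigma> t \<and> sort_of \<Sigma> t = L \<and> vars_tm t \<inter> {lv L, mv L, nv L} = {}"

abbreviation undir :: "('s, 'f) tm \<Rightarrow> ('s, 'f) tm \<Rightarrow> ('s, 'f, 'p) fm" where
  "undir s t \<equiv> Atom U [s, t]"

abbreviation reverse :: "('s, 'f) tm \<Rightarrow> ('s, 'f) tm" where
  "reverse t \<equiv> App r [t]"

lemma line_tm_Var [simp]: "line_tm (Var (i, L)) \<longleftrightarrow> 2 < i"
  by (auto simp: line_tm_def)

lemma line_tm_reverse [simp]: "line_tm t \<Longrightarrow> line_tm (reverse t)"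
  by (auto simp: line_tm_def rank_r)

text \<open>Settles well-sortedness of atoms without unfolding \<open>line_tm\<close>;
  \<open>wf_fm.simps(2)\<close> is removed from the simplifier below so that this rule can
  fire.\<close>

lemma wf_undir [simp]: "line_tm s \<Longrightarrow> line_tm t \<Longrightarrow> wf_fm \<Sigma> (undir s t)"
  by (auto simp: line_tm_def rank_U)

lemma sentence_axioms:
  "sentence \<Sigma> (I5 L U)" "sentence \<Sigma> (I6 L U)" "sentence \<Sigma> (I7 L U r)"
  "sentence \<Sigma> (I8 L U r)" "sentence \<Sigma> (ODO L U r)"
  by (auto simp: sentence_def I5_def I6_def I7_def I8_def ODO_def Let_def rank_U rank_r)

section \<open>Handling the quantifier prefixes of the axioms\<close>

lemma All1E:
  assumes "\<Sigma>, A \<turnstile> All (lv L) \<phi>" "free_for a (lv L) \<phi>" "line_tm a"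
  shows "\<Sigma>, A \<turnstile> subst (lv L) a \<phi>"
  using assms by (auto simp: line_tm_def intro: AllE)

text \<open>The inner quantifier binds a name absent from line terms, so the substitution passes
  under it and only the matrix needs a \<open>free_for\<close> condition.\<close>

lemma All2E:
  assumes "\<Sigma>, A \<turnstile> All (lv L) (All (mv L) \<phi>)"
    and "line_tm a" "line_tm b"
    and "free_for a (lv L) \<phi>" "free_for b (mv L) (subst (lv L) a \<phi>)"
  shows "\<Sigma>, A \<turnstile> subst (mv L) b (subst (lv L) a \<phi>)"
proof -
  have "\<Sigma>, A \<turnstile> All (mv L) (subst (lv L) a \<phi>)"
    using All1E[OF assms(1), of a] assms(2,4) by (auto simp: line_tm_def)
  then show ?thesis using assms(3,5) by (auto simp: line_tm_def intro: AllE)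
qed

lemma All3E:
  assumes "\<Sigma>, A \<turnstile> All (lv L) (All (mv L) (All (nv L) \<phi>))"
    and "line_tm a" "line_tm b" "line_tm c"
    and "free_for a (lv L) \<phi>" "free_for b (mv L) (subst (lv L) a \<phi>)"
      "free_for c (nv L) (subst (mv L) b (subst (lv L) a \<phi>))"
  shows "\<Sigma>, A \<turnstile> subst (nv L) c (subst (mv L) b (subst (lv L) a \<phi>))"
proof -
  have "\<Sigma>, A \<turnstile> All (nv L) (subst (mv L) b (subst (lv L) a \<phi>))"
    using All2E[OF assms(1), of a b] assms by (auto simp: line_tm_def)
  then show ?thesis using assms(4,7) by (auto simp: line_tm_def intro: AllE)
qed

text \<open>Generalizes from the innermost quantifier outwards. The bounds on \<open>fv\<close> show
  that each eigenvariable is fresh for the formula it generalizes.\<close>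

lemma All3I:
  assumes "\<Sigma>, A \<turnstile> subst (nv L) (Var (5, L)) (subst (mv L) (Var (4, L)) (subst (lv L) (Var (3, L)) \<phi>))"
    and "\<forall>\<alpha> \<in> A. fv \<alpha> = {}" "fv \<phi> \<subseteq> {lv L, mv L, nv L}"
    and "free_for (Var (3, L)) (lv L) \<phi>"
      "free_for (Var (4, L)) (mv L) (subst (lv L) (Var (3, L)) \<phi>)"
      "free_for (Var (5, L)) (nv L) (subst (mv L) (Var (4, L)) (subst (lv L) (Var (3, L)) \<phi>))"
    and "fv (subst (lv L) (Var (3, L)) \<phi>) \<subseteq> {(3, L), mv L, nv L}"
      "fv (subst (mv L) (Var (4, L)) (subst (lv L) (Var (3, L)) \<phi>)) \<subseteq> {(3, L), (4, L), nv L}"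
  shows "\<Sigma>, A \<turnstile> All (lv L) (All (mv L) (All (nv L) \<phi>))"
proof -
  have "\<Sigma>, A \<turnstile> All (nv L) (subst (mv L) (Var (4, L)) (subst (lv L) (Var (3, L)) \<phi>))"
    using assms by (intro AllI[where y = "(5, L)"]) auto
  then have "\<Sigma>, A \<turnstile> All (mv L) (All (nv L) (subst (lv L) (Var (3, L)) \<phi>))"
    using assms by (intro AllI[where y = "(4, L)"]) auto
  then show ?thesis
    using assms by (intro AllI[where y = "(3, L)"]) auto
qed

section \<open>The axioms at arbitrary line terms\<close>

lemma I5_inst:
  assumes "I5 L U \<in> A" "line_tm a"
  shows "\<Sigma>, A \<turnstile> \<^bold>\<not> undir a a"
proof -
  have "\<Sigma>, A \<turnstile> I5 L U"
    using assms(1) sentence_axioms by (intro Assm) (auto simp: sentence_def)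
  from All1E[OF this[unfolded I5_def Let_def], of a] show ?thesis
    using assms(2) by simp
qed

lemma I6_inst:
  assumes "I6 L U \<in> A" "line_tm a" "line_tm b" "line_tm c"
  shows "\<Sigma>, A \<turnstile> undir a b \<^bold>\<longrightarrow> undir a c \<^bold>\<or> undir b c"
proof -
  have "\<Sigma>, A \<turnstile> I6 L U"
    using assms(1) sentence_axioms by (intro Assm) (auto simp: sentence_def)
  from All3E[OF this[unfolded I6_def Let_def], of a b c] show ?thesis
    using assms(2-4) by (auto simp: line_tm_def subst_tm_fresh)
qed

lemma I7_inst:
  assumes "I7 L U r \<in> A" "line_tm a" "line_tm b" "line_tm c"
  shows "\<Sigma>, A \<turnstile> undir a b \<^bold>\<and> undir a (reverse b) \<^bold>\<longrightarrow>
    (undir a c \<^bold>\<and> undir a (reverse c)) \<^bold>\<or> (undir b c \<^bold>\<and> undir b (reverse c))"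
proof -
  have "\<Sigma>, A \<turnstile> I7 L U r"
    using assms(1) sentence_axioms by (intro Assm) (auto simp: sentence_def)
  from All3E[OF this[unfolded I7_def Let_def], of a b c] show ?thesis
    using assms(2-4) by (auto simp: line_tm_def subst_tm_fresh)
qed

lemma I8_inst:
  assumes "I8 L U r \<in> A" "line_tm a" "line_tm b"
  shows "\<Sigma>, A \<turnstile> undir a b \<^bold>\<or> undir a (reverse b)"
proof -
  have "\<Sigma>, A \<turnstile> I8 L U r"
    using assms(1) sentence_axioms by (intro Assm) (auto simp: sentence_def)
  from All2E[OF this[unfolded I8_def Let_def], of a b] show ?thesis
    using assms(2,3) by (auto simp: line_tm_def subst_tm_fresh)
qed

lemma ODO_inst:
  assumes "ODO L U r \<in> A" "line_tm a" "line_tm b" "line_tm c"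
  shows "\<Sigma>, A \<turnstile> \<^bold>\<not> undir a (reverse b) \<^bold>\<and> \<^bold>\<not> undir a c \<^bold>\<longrightarrow> \<^bold>\<not> undir b (reverse c)"
proof -
  have "\<Sigma>, A \<turnstile> ODO L U r"
    using assms(1) sentence_axioms by (intro Assm) (auto simp: sentence_def)
  from All3E[OF this[unfolded ODO_def Let_def], of a b c] show ?thesis
    using assms(2-4) by (auto simp: line_tm_def subst_tm_fresh)
qed

lemma I8_contradiction:
  assumes "I8 L U r \<in> A" "line_tm a" "line_tm b"
    and "\<Sigma>, A \<turnstile> \<^bold>\<not> undir a b" "\<Sigma>, A \<turnstile> \<^bold>\<not> undir a (reverse b)"
  shows "\<Sigma>, A \<turnstile> \<^bold>\<bottom>"
proof (rule ImpE)
  show "\<Sigma>, A \<turnstile> \<^bold>\<not> (undir a b \<^bold>\<or> undir a (reverse b))"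
    using assms by (intro neg_disjI) (simp_all del: wf_fm.simps)
qed (rule I8_inst[OF assms(1-3)])

text \<open>Classically, the negated conjunctions express parallelism irrespective of orientation;
  contraposed, I.7 says that two lines parallel to a third in this sense are parallel.\<close>

lemma I7_contraposed:
  assumes "I7 L U r \<in> A" "line_tm a" "line_tm b" "line_tm c"
    and "\<Sigma>, A \<turnstile> \<^bold>\<not> (undir a c \<^bold>\<and> undir a (reverse c))" "\<Sigma>, A \<turnstile> \<^bold>\<not> (undir b c \<^bold>\<and> undir b (reverse c))"
  shows "\<Sigma>, A \<turnstile> \<^bold>\<not> (undir a b \<^bold>\<and> undir a (reverse b))"
proof (rule modus_tollens[OF I7_inst[OF assms(1-4)]])
  show "\<Sigma>, A \<turnstile> \<^bold>\<not> ((undir a c \<^bold>\<and> undir a (reverse c)) \<^bold>\<or> (undir b c \<^bold>\<and> undir b (reverse c)))"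
    using assms by (intro neg_disjI) (simp_all del: wf_fm.simps(2))
qed (use assms in \<open>simp_all del: wf_fm.simps(2)\<close>)

section \<open>Equivalence of I.6 and ODO\<close>

lemma I6_euclidean:
  assumes "I6 L U \<in> A" "line_tm a" "line_tm b" "line_tm c"
    and "\<Sigma>, A \<turnstile> \<^bold>\<not> undir a c" "\<Sigma>, A \<turnstile> \<^bold>\<not> undir b c"
  shows "\<Sigma>, A \<turnstile> \<^bold>\<not> undir a b"
  using I6_inst[OF assms(1-4)]
proof (rule modus_tollens)
  show "\<Sigma>, A \<turnstile> \<^bold>\<not> (undir a c \<^bold>\<or> undir b c)"
    using assms by (intro neg_disjI) (simp_all del: wf_fm.simps)
qed (use assms in \<open>simp_all del: wf_fm.simps(2)\<close>)

text \<open>Take \<open>b\<close> itself as the common line in \<open>I6_euclidean\<close>; the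
  extra premise is then reflexivity, which is I.5.\<close>

lemma I6_sym:
  assumes "I5 L U \<in> A" "I6 L U \<in> A" "line_tm a" "line_tm b" "\<Sigma>, A \<turnstile> \<^bold>\<not> undir a b"
  shows "\<Sigma>, A \<turnstile> \<^bold>\<not> undir b a"
  using assms by (intro I6_euclidean[of A b a b] I5_inst)

lemma ODO_derivable:
  assumes closed: "\<forall>\<alpha> \<in> A. fv \<alpha> = {}"
    and axioms: "I5 L U \<in> A" "I6 L U \<in> A" "I7 L U r \<in> A" "I8 L U r \<in> A"
  shows "\<Sigma>, A \<turnstile> ODO L U r"
proof -
  \<comment> \<open>The eigenvariables of \<open>All3I\<close>, kept opaque as line terms until the
    quantifiers are introduced.\<close>
  define l m n :: "('s, 'f) tm" where vars: "l = Var (3, L)" "m = Var (4, L)" "n = Var (5, L)"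
  have [simp]: "line_tm l" "line_tm m" "line_tm n" by (simp_all add: vars)
  let ?H = "\<^bold>\<not> undir l (reverse m) \<^bold>\<and> \<^bold>\<not> undir l n"
  let ?B = "insert (undir m (reverse n)) (insert ?H A)"
  note [simp del] = wf_fm.simps(2)
  have ax: "I5 L U \<in> ?B" "I6 L U \<in> ?B" "I7 L U r \<in> ?B" "I8 L U r \<in> ?B"
    using axioms by simp_all
  have H: "\<Sigma>, ?B \<turnstile> ?H" by (rule Assm) simp_all
  have mn: "\<Sigma>, ?B \<turnstile> undir m (reverse n)" by (rule Assm) simp_all
  \<comment> \<open>\<open>I6_euclidean\<close> needs the common line \<open>l\<close> in second
    position, so both hypotheses are reversed first.\<close>
  have "\<Sigma>, ?B \<turnstile> \<^bold>\<not> undir (reverse m) l"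
    using ConjE1[OF H] ax by (intro I6_sym[of _ l]) simp_all
  moreover have "\<Sigma>, ?B \<turnstile> \<^bold>\<not> undir n l"
    using ConjE2[OF H] ax by (intro I6_sym[of _ l]) simp_all
  ultimately have n_reverse_m: "\<Sigma>, ?B \<turnstile> \<^bold>\<not> undir n (reverse m)"
    using ax by - (rule I6_euclidean[of _ n "reverse m" l]; simp)
  have "\<Sigma>, ?B \<turnstile> \<^bold>\<not> (undir m n \<^bold>\<and> undir m (reverse n))"
  \<comment> \<open>With \<open>m\<close> as third line, one alternative of I.7 fails by reflexivity
    and the other by \<open>n_reverse_m\<close>.\<close>
  proof (rule I7_contraposed[OF ax(3)])
    show "\<Sigma>, ?B \<turnstile> \<^bold>\<not> (undir m m \<^bold>\<and> undir m (reverse m))"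
      using ax(1) by (intro neg_conjI1 I5_inst) simp_all
    show "\<Sigma>, ?B \<turnstile> \<^bold>\<not> (undir n m \<^bold>\<and> undir n (reverse m))"
      using n_reverse_m by (intro neg_conjI2) simp_all
  qed simp_all
  then have "\<Sigma>, ?B \<turnstile> \<^bold>\<not> undir m n"
    using mn by (rule neg_conjD1) simp_all
  then have "\<Sigma>, ?B \<turnstile> \<^bold>\<not> undir n m"
    using ax by (intro I6_sym[of _ m]) simp_all
  then have "\<Sigma>, ?B \<turnstile> \<^bold>\<bottom>"
    using n_reverse_m ax by (intro I8_contradiction[of _ n m]) simp_all
  then have "\<Sigma>, A \<turnstile> ?H \<^bold>\<longrightarrow> \<^bold>\<not> undir m (reverse n)"
    by (intro ImpI) simp_all
  then show ?thesis
    unfolding ODO_def Let_def vars by (intro All3I closed) auto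
qed

lemma I6_derivable:
  assumes closed: "\<forall>\<alpha> \<in> A. fv \<alpha> = {}"
    and axioms: "ODO L U r \<in> A" "I7 L U r \<in> A" "I8 L U r \<in> A"
  shows "\<Sigma>, A \<turnstile> I6 L U"
proof -
  define l m n :: "('s, 'f) tm" where vars: "l = Var (3, L)" "m = Var (4, L)" "n = Var (5, L)"
  have [simp]: "line_tm l" "line_tm m" "line_tm n" by (simp_all add: vars)
  let ?D = "undir l n \<^bold>\<or> undir m n"
  let ?B = "insert (\<^bold>\<not> ?D) (insert (undir l m) A)"
  note [simp del] = wf_fm.simps(2)
  have ax: "ODO L U r \<in> ?B" "I7 L U r \<in> ?B" "I8 L U r \<in> ?B"
    using axioms by simp_all
  have D: "\<Sigma>, ?B \<turnstile> \<^bold>\<not> ?D" by (rule Assm) simp_all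
  have lm: "\<Sigma>, ?B \<turnstile> undir l m" by (rule Assm) simp_all
  have ln: "\<Sigma>, ?B \<turnstile> \<^bold>\<not> undir l n" using D by (rule neg_disjD1) simp_all
  have mn: "\<Sigma>, ?B \<turnstile> \<^bold>\<not> undir m n" using D by (rule neg_disjD2) simp_all
  have "\<Sigma>, ?B \<turnstile> \<^bold>\<not> (undir l m \<^bold>\<and> undir l (reverse m))"
    \<comment> \<open>With \<open>n\<close> as third line, \<open>ln\<close> and \<open>mn\<close>
      refute the first conjunct of each alternative.\<close>
    by (rule I7_contraposed[OF ax(2), of _ _ n]; (rule neg_conjI1)?; simp add: ln mn)
  then have "\<Sigma>, ?B \<turnstile> \<^bold>\<not> undir l (reverse m)"
    using lm by (rule neg_conjD2) simp_all
  then have "\<Sigma>, ?B \<turnstile> \<^bold>\<not> undir l (reverse m) \<^bold>\<and> \<^bold>\<not> undir l n"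
    using ln by (rule ConjI)
  then have "\<Sigma>, ?B \<turnstile> \<^bold>\<not> undir m (reverse n)"
    by (rule ImpE[OF ODO_inst[OF ax(1)], rotated -1]) simp_all
  then have "\<Sigma>, ?B \<turnstile> \<^bold>\<bottom>"
    using mn ax by (intro I8_contradiction[of _ m n]) simp_all
  \<comment> \<open>The classical step: \<open>RAA\<close> discharges the negated disjunction, the
    outermost assumption of \<open>?B\<close>, before \<open>ImpI\<close> discharges
    \<open>undir l m\<close>.\<close>
  then have "\<Sigma>, A \<turnstile> undir l m \<^bold>\<longrightarrow> ?D"
    by (rule ImpI[OF RAA]) simp_all
  then show ?thesis
    unfolding I6_def Let_def vars by (intro All3I closed) auto
qed

end

theorem theorem2:
  fixes \<Sigma> :: "('s, 'f, 'p) signature"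
    and line :: 's and Undir :: 'p and rv :: 'f
    and \<Gamma> :: "('s, 'f, 'p) fm set"
  assumes "pred_rank \<Sigma> Undir = [line, line]"
    and "fun_rank \<Sigma> rv = ([line], line)"
    and "\<forall>\<phi> \<in> \<Gamma>. sentence \<Sigma> \<phi>"
  shows "equivalent_axiomatizations \<Sigma>
    (\<Gamma> \<union> {I5 line Undir, I6 line Undir, I7 line Undir rv, I8 line Undir rv})
    (\<Gamma> \<union> {I5 line Undir, ODO line Undir rv, I7 line Undir rv, I8 line Undir rv})"
    (is "equivalent_axiomatizations \<Sigma> ?A ?B")
proof -
  interpret line_signature \<Sigma> line Undir rv
    using assms(1,2) by unfold_locales
  \<comment> \<open>Closedness of every axiom, those of \<open>\<Gamma>\<close> included, supplies
    the eigenvariable conditions; well-sortedness is what \<open>Assm\<close> requires.\<close>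
  have A: "\<forall>\<phi> \<in> ?A. sentence \<Sigma> \<phi>" and B: "\<forall>\<phi> \<in> ?B. sentence \<Sigma> \<phi>"
    using assms(3) sentence_axioms by auto
  have "\<Sigma>, ?A \<turnstile> ODO line Undir rv"
    using A by (intro ODO_derivable) (auto simp: sentence_def)
  moreover have "\<Sigma>, ?B \<turnstile> I6 line Undir"
    using B by (intro I6_derivable) (auto simp: sentence_def)
  moreover have "\<Sigma>, ?A \<turnstile> \<phi>" if "\<phi> \<in> ?A" for \<phi>
    using that A by (intro Assm) (auto simp: sentence_def)
  moreover have "\<Sigma>, ?B \<turnstile> \<phi>" if "\<phi> \<in> ?B" for \<phi>
    using that B by (intro Assm) (auto simp: sentence_def)
  ultimately show ?thesis
    unfolding equivalent_axiomatizations_def by blast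
qed

end
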